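(* Let $r\ge1$, let $p_1,\dots,p_r\ge5$ be distinct primes, and $P=p_1\cdots p_r$. Let $n$ be a positive integer. If $P\le\sqrt{2n}$, then $g_P(2n)>0$.
   Context: $M=6P$. $g_P(2n)$ is the number of pairs $(h,k)\in\mathbb Z_{>0}^2$ with $h+k=2n$, $h\le k$, $\gcd(h,M)=\gcd(k,M)=1$. *)

theory Defs
  imports Complex_Main "HOL-Computational_Algebra.Primes"
begin

text \<open>The paper only evaluates this function at even arguments \<open>N = 2 * n\<close>.
  The set is finite because of \<open>h + k = N\<close>, so \<open>card\<close> is the true number of pairs.\<close>

definition g :: "nat \<Rightarrow> nat \<Rightarrow> nat" where
  "g P N = card {(h, k). 0 < h \<and> 0 < k \<and> h + k = N \<and> h \<le> k
                       \<and> gcd h (6 * P) = 1 \<and> gcd k (6 * P) = 1}"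

end

theory Submission
  imports Defs "HOL-Number_Theory.Cong"
begin

text \<open>Modulo each prime dividing \<open>6 P\<close> there is a residue different from both \<open>0\<close> and \<open>2 n\<close>; this
  uses that \<open>2 n\<close> is even. The Chinese remainder theorem combines them to some \<open>h < 6 P\<close> such that
  \<open>h\<close> and \<open>2 n - h\<close> are coprime to \<open>6 P\<close>. If \<open>P \<ge> 6\<close>, then \<open>6 P \<le> P\<^sup>2 \<le> 2 n\<close>, so \<open>h\<close> is in range.
  Otherwise \<open>P = 5\<close>, and only \<open>26 = 13 + 13\<close> and \<open>28 = 11 + 17\<close> are not covered by \<open>6 P \<le> 2 n\<close>.\<close>

lemma g_pos_if_coprime_summands:
  assumes "0 < h" "0 < k" "coprime h (6 * P)" "coprime k (6 * P)"
  shows "g P (h + k) > 0"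
proof -
  let ?S = "{(a, b). 0 < a \<and> 0 < b \<and> a + b = h + k \<and> a \<le> b
                       \<and> gcd a (6 * P) = 1 \<and> gcd b (6 * P) = 1}"
  \<comment> \<open>Finiteness matters because \<open>card\<close> is 0 on infinite sets.\<close>
  have "?S \<subseteq> {..h + k} \<times> {..h + k}"
    by auto
  then have "finite ?S"
    by (rule finite_subset) simp
  moreover have "(min h k, max h k) \<in> ?S"
    using assms by (auto simp: min_def max_def coprime_iff_gcd_eq_1)
  ultimately show ?thesis
    unfolding g_def by (metis (no_types, lifting) card_gt_0_iff empty_iff)
qed

text \<open>The residue 1 works unless \<open>N\<close> is 1 modulo \<open>q\<close>. In that case
  \<open>q\<close> is odd because \<open>N\<close> is even, and 2 works.\<close>

lemma ex_residue_avoiding_zero_and: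
  fixes q N :: nat
  assumes "prime q" "even N"
  obtains u where "\<not> [u = 0] (mod q)" "\<not> [u = N] (mod q)"
proof (cases "N mod q = 1")
  case True
  then have "q \<noteq> 2"
    using assms(2) by auto
  then have "q > 2"
    using prime_ge_2_nat[OF assms(1)] by simp
  then show ?thesis
    using True by (intro that[of 2]) (auto simp: cong_def)
next
  case False
  then show ?thesis
    using prime_gt_1_nat[OF assms(1)] by (intro that[of 1]) (auto simp: cong_def)
qed

lemma ex_summand_coprime_to_primes:
  fixes A :: "nat set" and N :: nat
  assumes "finite A" "\<And>q. q \<in> A \<Longrightarrow> prime q" "even N" "\<Prod>A \<le> N"
  obtains h where "h < \<Prod>A" "coprime h (\<Prod>A)" "coprime (N - h) (\<Prod>A)"
proof -
  have "\<forall>q\<in>A. \<exists>u. \<not> [u = 0] (mod q) \<and> \<not> [u = N] (mod q)"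
    by (metis assms(2,3) ex_residue_avoiding_zero_and)
  then obtain u where u: "\<And>q. q \<in> A \<Longrightarrow> \<not> [u q = 0] (mod q) \<and> \<not> [u q = N] (mod q)"
    by metis
  have "\<forall>i\<in>A. \<forall>j\<in>A. i \<noteq> j \<longrightarrow> coprime i j"
    using assms(2) primes_coprime by blast
  moreover have "\<forall>q\<in>A. q \<noteq> 0"
    using assms(2) by (auto dest: prime_gt_0_nat)
  ultimately obtain h where h: "h < \<Prod>A" "\<forall>q\<in>A. [h = u q] (mod q)"
    using chinese_remainder_unique_nat[OF assms(1), of "\<lambda>q. q" u] by auto
  have ndvd: "\<not> q dvd h \<and> \<not> q dvd N - h" if "q \<in> A" for q
  proof
    show "\<not> q dvd h"
      using u[OF that] h(2) that by (metis cong_0_iff cong_sym cong_trans)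
    \<comment> \<open>As \<open>h < \<Prod>A \<le> N\<close>, the subtraction is not truncated, so
      \<open>q dvd N - h\<close> would make \<open>u q\<close> congruent to
      \<open>N\<close>.\<close>
    show "\<not> q dvd N - h"
      using u[OF that] h assms(4) that
      by (metis cong_altdef_nat cong_sym cong_trans less_imp_le order_trans)
  qed
  then have "coprime q h" "coprime q (N - h)" if "q \<in> A" for q
    using that assms(2) prime_imp_coprime by blast+
  then have "coprime h (\<Prod>A)" "coprime (N - h) (\<Prod>A)"
    by (auto intro!: prod_coprime_right simp: coprime_commute)
  with h(1) show ?thesis
    by (rule that)
qed

theorem corollary5p11:
  fixes r n P :: nat and p :: "nat \<Rightarrow> nat"
  assumes "r \<ge> 1"
    and "\<And>i. i \<in> {1..r} \<Longrightarrow> prime (p i)"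
    and "\<And>i. i \<in> {1..r} \<Longrightarrow> p i \<ge> 5"
    and "inj_on p {1..r}"
    and "P = (\<Prod>i = 1..r. p i)"
    and "n > 0"
    and "real P \<le> sqrt (real (2 * n))"
  shows "g P (2 * n) > 0"
proof -
  have "(real P)\<^sup>2 \<le> real (2 * n)"
    using assms(7) by (simp add: real_le_rsqrt sqrt_ge_absD)
  then have sq: "P * P \<le> 2 * n"
    by (metis of_nat_le_iff of_nat_mult power2_eq_square)
  have "P \<noteq> 0"
    using assms(2) by (auto simp: assms(5) intro!: prime_gt_0_nat)
  moreover have "p 1 dvd P"
    unfolding assms(5) using assms(1) by (intro dvd_prodI) auto
  ultimately have "P \<ge> 5"
    using assms(1) assms(3)[of 1] by (auto dest!: dvd_imp_le)
  show ?thesis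
  proof (cases "6 * P \<le> 2 * n")
    case True
    let ?Q = "p ` {1..r}"
    let ?A = "insert 2 (insert 3 ?Q)"
    \<comment> \<open>The bound \<open>p i \<ge> 5\<close> and injectivity ensure that no factor is
      lost when the product is taken over a set.\<close>
    have "2 \<notin> ?Q" "3 \<notin> ?Q"
      using assms(3) by force+
    moreover have "\<Prod>?Q = P"
      using assms(4,5) by (simp add: prod.reindex)
    ultimately have A: "\<Prod>?A = 6 * P"
      by simp
    have "prime q" if "q \<in> ?A" for q
      using that assms(2) by auto
    then obtain h where h: "h < 6 * P" "coprime h (6 * P)" "coprime (2 * n - h) (6 * P)"
      using ex_summand_coprime_to_primes[of ?A "2 * n"] True unfolding A by auto
    \<comment> \<open>\<open>h = 0\<close> would have gcd \<open>6 * P\<close> with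
      \<open>6 * P\<close>. The other summand is positive since
      \<open>h < 6 * P \<le> 2 * n\<close>.\<close>
    moreover have "h > 0"
      using h(2) by (cases h) auto
    ultimately show ?thesis
      using True g_pos_if_coprime_summands[of h "2 * n - h" P] by simp
  next
    case False
    have "P < 6"
    proof (rule ccontr)
      assume "\<not> P < 6"
      then have "6 * P \<le> P * P"
        by simp
      then show False
        using sq False by linarith
    qed
    with \<open>P \<ge> 5\<close> have "P = 5"
      by simp
    \<comment> \<open>The bounds are now \<open>25 \<le> 2 * n < 30\<close>.\<close>
    then have "n = 13 \<or> n = 14"
      using sq False by auto
    moreover have "coprime 13 (30 :: nat)" "coprime 11 (30 :: nat)" "coprime 17 (30 :: nat)"
      by (simp_all add: coprime_iff_gcd_eq_1 gcd_non_0_nat)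
    ultimately show ?thesis
      using \<open>P = 5\<close> g_pos_if_coprime_summands[of 13 13 5] g_pos_if_coprime_summands[of 11 17 5]
      by auto
  qed
qed

end
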